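(* Let $a<b$ be real numbers, $\alpha\in(0,1)$, and let $p,q,r$ be real-valued continuous functions on $[a,b]$ with $p(t)>0$ and $r(t)>0$ for all $t\in[a,b]$. Consider the fractional Sturm--Liouville operator $$L_1x(t)={}^{ABR}_{a}D^\alpha\big(p(t)\,{}^{ABR}D^\alpha_b x(t)\big)+q(t)x(t).$$ Then $L_1$ is self-adjoint with respect to the inner product $\langle u,v\rangle=\int_a^b\overline{u(t)}\,v(t)\,dt$; that is, $\langle L_1u,v\rangle=\langle u,L_1v\rangle$ for all complex-valued functions $u,v$ in the domain of $L_1$.
   Context: For $\alpha\in(0,1)$, $E_\alpha(z)=\sum_{k=0}^\infty \frac{z^k}{\Gamma(\alpha k+1)}$ is the Mittag-Leffler function, and $B(\alpha)>0$ is a normalization constant. For a (complex-valued) $f\in H^1(a,b)$, identified with its continuous representative on $[a,b]$, the left and right ABR (Riemann--Liouville type) fractional derivatives with Mittag-Leffler kernel are $${}^{ABR}_{a}D^\alpha f(t)=\frac{B(\alpha)}{1-\alpha}\frac{d}{dt}\int_a^t f(x)E_\alpha\Big(\tfrac{-\alpha}{1-\alpha}(t-x)^\alpha\Big)dx,\qquad {}^{ABR}D^\alpha_b f(t)=-\frac{B(\alpha)}{1-\alpha}\frac{d}{dt}\int_t^b f(x)E_\alpha\Big(\tfrac{-\alpha}{1-\alpha}(x-t)^\alpha\Big)dx,$$ with one-sided derivatives at the endpoints of $[a,b]$. The domain of $L_1$ consists of the functions $x\in H^1(a,b)$ such that $p\cdot{}^{ABR}D_b^\alpha x\in H^1(a,b)$,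 so that both derivatives in $L_1x$ are applied to functions in $H^1(a,b)$. *)

theory Defs
  imports "HOL-Analysis.Analysis"
begin

definition L2_on :: "real \<Rightarrow> real \<Rightarrow> (real \<Rightarrow> complex) \<Rightarrow> bool" where
  "L2_on a b f \<longleftrightarrow>
     set_borel_measurable lebesgue {a<..<b} f \<and>
     set_integrable lebesgue {a<..<b} (\<lambda>t. (cmod (f t))\<^sup>2)"

text \<open>Test functions are real-valued; by linearity this gives the same weak derivatives of
  complex-valued functions as complex-valued test functions.\<close>

definition test_function :: "real \<Rightarrow> real \<Rightarrow> (real \<Rightarrow> real) \<Rightarrow> bool" where
  "test_function a b \<phi> \<longleftrightarrow>
     (\<forall>n. (deriv ^^ n) \<phi> differentiable_on UNIV) \<and>
     compact (closure {t. \<phi> t \<noteq> 0}) \<and> closure {t. \<phi> t \<noteq> 0} \<subseteq> {a<..<b}"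

definition weak_derivative ::
  "real \<Rightarrow> real \<Rightarrow> (real \<Rightarrow> complex) \<Rightarrow> (real \<Rightarrow> complex) \<Rightarrow> bool" where
  "weak_derivative a b f g \<longleftrightarrow>
     (\<forall>\<phi>. test_function a b \<phi> \<longrightarrow>
        (LINT t:{a<..<b}|lebesgue. f t * of_real (deriv \<phi> t)) =
        - (LINT t:{a<..<b}|lebesgue. g t * of_real (\<phi> t)))"

text \<open>The Sobolev space \<open>H\<^sup>1(a,b)\<close>, each class being represented by its continuous
  representative on \<open>[a,b]\<close>. Values outside \<open>[a,b]\<close> are irrelevant.\<close>

definition H1 :: "real \<Rightarrow> real \<Rightarrow> (real \<Rightarrow> complex) set" where
  "H1 a b = {f. continuous_on {a..b} f \<and> L2_on a b f \<and>
                (\<exists>g. L2_on a b g \<and> weak_derivative a b f g)}"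

definition mittag_leffler :: "real \<Rightarrow> 'a \<Rightarrow> 'a::{real_normed_field,banach}" where
  "mittag_leffler \<alpha> z = (\<Sum>k. z ^ k / of_real (Gamma (\<alpha> * real k + 1)))"

definition abr_kernel :: "real \<Rightarrow> real \<Rightarrow> real" where
  "abr_kernel \<alpha> s = mittag_leffler \<alpha> (- \<alpha> / (1 - \<alpha>) * s powr \<alpha>)"

text \<open>Differentiating within \<open>[a,b]\<close> yields the one-sided derivatives at the endpoints.
  For \<open>f\<close> in \<open>H\<^sup>1(a,b)\<close> the integrals below are differentiable
  at every point of \<open>[a,b]\<close>, with continuous derivative.\<close>

definition abr_left ::
  "(real \<Rightarrow> real) \<Rightarrow> real \<Rightarrow> real \<Rightarrow> real \<Rightarrow> (real \<Rightarrow> complex) \<Rightarrow> real \<Rightarrow> complex" where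
  "abr_left B \<alpha> a b f t =
     of_real (B \<alpha> / (1 - \<alpha>)) *
     vector_derivative
       (\<lambda>s. LINT x:{a..s}|lebesgue. f x * of_real (abr_kernel \<alpha> (s - x)))
       (at t within {a..b})"

definition abr_right ::
  "(real \<Rightarrow> real) \<Rightarrow> real \<Rightarrow> real \<Rightarrow> real \<Rightarrow> (real \<Rightarrow> complex) \<Rightarrow> real \<Rightarrow> complex" where
  "abr_right B \<alpha> a b f t =
     - of_real (B \<alpha> / (1 - \<alpha>)) *
     vector_derivative
       (\<lambda>s. LINT x:{s..b}|lebesgue. f x * of_real (abr_kernel \<alpha> (x - s)))
       (at t within {a..b})"

definition L1_op ::
  "(real \<Rightarrow> real) \<Rightarrow> real \<Rightarrow> real \<Rightarrow> real \<Rightarrow> (real \<Rightarrow> real) \<Rightarrow> (real \<Rightarrow> real) \<Rightarrow>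
   (real \<Rightarrow> complex) \<Rightarrow> real \<Rightarrow> complex" where
  "L1_op B \<alpha> a b p q x t =
     abr_left B \<alpha> a b (\<lambda>s. of_real (p s) * abr_right B \<alpha> a b x s) t + of_real (q t) * x t"

definition L1_domain ::
  "(real \<Rightarrow> real) \<Rightarrow> real \<Rightarrow> real \<Rightarrow> real \<Rightarrow> (real \<Rightarrow> real) \<Rightarrow> (real \<Rightarrow> complex) set" where
  "L1_domain B \<alpha> a b p =
     {x \<in> H1 a b. (\<lambda>t. of_real (p t) * abr_right B \<alpha> a b x t) \<in> H1 a b}"

definition L2_inner :: "real \<Rightarrow> real \<Rightarrow> (real \<Rightarrow> complex) \<Rightarrow> (real \<Rightarrow> complex) \<Rightarrow> complex" where
  "L2_inner a b u v = (LINT t:{a..b}|lebesgue. cnj (u t) * v t)"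

end

theory Submission
  imports Defs
begin

text \<open>
  Write \<open>K\<close> for the Mittag-Leffler kernel and \<open>k\<close> for its derivative, which is \<open>O(s powr (\<alpha> - 1))\<close> and
  hence integrable at \<open>0\<close>. Since \<open>K(s) = 1 + \<integral>\<^sub>0\<^sup>s k\<close>, Fubini's theorem turns
  \<open>\<integral>\<^sub>a\<^sup>t f(x) K(t - x) dx\<close> into the integral over \<open>[a,t]\<close> of the continuous function \<open>f + k * f\<close>. So for
  merely continuous \<open>f\<close> the left derivative is \<open>c (f + k * f)\<close>, and likewise the right derivative is
  \<open>c (f + k' * f)\<close> with the reflected kernel \<open>k'(y) = k(-y)\<close>, where \<open>c = B(\<alpha>) / (1 - \<alpha>)\<close>. These two
  operators are adjoint by Fubini again, so no integration by parts and no boundary terms arise,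
  and \<open>L\<^sub>1 = A p A\<^sup>* + q\<close> is symmetric, \<open>A\<close> being the left derivative.
\<close>

subsection \<open>The Mittag-Leffler kernel\<close>

text \<open>Restricts Euler's integral to \<open>[M, M+1]\<close>; as \<open>M\<close> is arbitrary, this gives summability of the
  Mittag-Leffler series without Stirling's formula.\<close>

lemma Gamma_plus1_lower_bound:
  fixes x M :: real
  assumes "0 \<le> x" "0 < M"
  shows "M powr x / exp (M + 1) \<le> Gamma (x + 1)"
proof -
  have "((\<lambda>t. M powr x / exp (M + 1)) has_integral (M powr x / exp (M + 1)) * (M + 1 - M)) {M..M+1}"
    using has_integral_const_real[of "M powr x / exp (M + 1)" M "M + 1"] by simp
  moreover have "(\<lambda>t. t powr x / exp t) integrable_on {M..M+1}"
    using assms by (intro integrable_continuous_real continuous_intros) auto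
  ultimately have "M powr x / exp (M + 1) \<le> integral {M..M+1} (\<lambda>t. t powr x / exp t)"
    using assms
    by (intro order_trans[OF _ has_integral_le[OF _ integrable_integral]])
       (auto intro!: frac_le powr_mono2)
  also have "\<dots> \<le> Gamma (x + 1)"
    using Gamma_integral_real[of "x + 1"] assms
    by (intro has_integral_subset_le[OF _ integrable_integral])
       (auto intro!: integrable_continuous_real continuous_intros)
  finally show ?thesis .
qed

lemma summable_mittag_leffler:
  fixes z :: "'a::{real_normed_field,banach}"
  assumes "0 < \<alpha>"
  shows "summable (\<lambda>k. z ^ k / of_real (Gamma (\<alpha> * real k + 1)))"
proof (rule summable_comparison_test')
  \<comment> \<open>With \<open>M powr \<alpha> = R\<close> the Gamma bound at
    \<open>\<alpha> * k\<close> reads \<open>R ^ k / exp (M + 1)\<close>; since \<open>R\<close>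
    exceeds \<open>2 * norm z\<close>, a geometric series of ratio 1/2 dominates the terms.\<close>
  define R where "R = 2 * norm z + 1"
  define M where "M = R powr (1 / \<alpha>)"
  have R: "R > 0"
    unfolding R_def by (intro add_nonneg_pos) auto
  then have M: "M > 0"
    by (simp add: M_def)
  show "summable (\<lambda>k. exp (M + 1) * (1 / 2) ^ k)"
    by (intro summable_mult summable_geometric) auto
  show "norm (z ^ k / of_real (Gamma (\<alpha> * real k + 1))) \<le> exp (M + 1) * (1 / 2) ^ k" for k
  proof -
    have "M powr (\<alpha> * real k) = R ^ k"
      using assms R by (simp add: M_def powr_powr powr_realpow)
    then have G: "R ^ k / exp (M + 1) \<le> Gamma (\<alpha> * real k + 1)"
      using Gamma_plus1_lower_bound[of "\<alpha> * real k" M] assms M by simp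
    have pos: "0 < R ^ k / exp (M + 1)"
      using R by simp
    have "norm (z ^ k / of_real (Gamma (\<alpha> * real k + 1))) \<le> norm z ^ k / (R ^ k / exp (M + 1))"
      using G pos unfolding norm_divide norm_power norm_of_real
      by (intro divide_left_mono mult_pos_pos) (auto intro: less_le_trans)
    also have "\<dots> = exp (M + 1) * (norm z / R) ^ k"
      by (simp add: power_divide)
    also have "\<dots> \<le> exp (M + 1) * (1 / 2) ^ k"
      using R by (intro mult_left_mono power_mono) (auto simp: divide_le_eq R_def)
    finally show ?thesis .
  qed
qed

lemma mittag_leffler_powser:
  "mittag_leffler \<alpha> = (\<lambda>z. \<Sum>k. inverse (of_real (Gamma (\<alpha> * real k + 1))) * z ^ k)"
  by (simp add: mittag_leffler_def fun_eq_iff field_simps)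

lemma DERIV_mittag_leffler:
  assumes "0 < \<alpha>"
  shows "(mittag_leffler \<alpha> has_field_derivative deriv (mittag_leffler \<alpha>) z) (at z)"
proof -
  have "summable (\<lambda>k. inverse (of_real (Gamma (\<alpha> * real k + 1))) * y ^ k)" for y :: 'a
    using summable_mittag_leffler[OF assms, of y] by (simp add: field_simps)
  from termdiffs_strong_converges_everywhere[OF this, of z] show ?thesis
    unfolding mittag_leffler_powser using DERIV_imp_deriv by fastforce
qed

text \<open>Termwise differentiation yields another power series converging everywhere, and such
  sums are continuous.\<close>

lemma continuous_deriv_mittag_leffler:
  assumes "0 < \<alpha>"
  shows "continuous_on UNIV (deriv (mittag_leffler \<alpha> :: 'a::{real_normed_field,banach} \<Rightarrow> 'a))"
proof -
  define c where "c = (\<lambda>k. inverse (of_real (Gamma (\<alpha> * real k + 1))) :: 'a)"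
  have s: "summable (\<lambda>k. c k * y ^ k)" for y
    using summable_mittag_leffler[OF assms, of y] by (simp add: field_simps c_def)
  have "mittag_leffler \<alpha> = (\<lambda>z. \<Sum>k. c k * z ^ k)"
    by (simp add: mittag_leffler_powser c_def)
  then have "deriv (mittag_leffler \<alpha>) = (\<lambda>z. \<Sum>k. diffs c k * z ^ k)"
    using termdiffs_strong_converges_everywhere[OF s] by (auto intro!: DERIV_imp_deriv)
  moreover have "summable (\<lambda>k. diffs c k * y ^ k)" for y
    by (rule termdiff_converges_all[OF s])
  ultimately show ?thesis
    by (auto simp: continuous_on_eq_continuous_at intro!: isCont_powser_converges_everywhere)
qed

text \<open>The chain-rule derivative of \<open>abr_kernel \<alpha>\<close> at positive
  \<open>s\<close>; the value at the singular point 0 is 0, since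
  \<open>0 powr x = 0\<close>.\<close>

definition abr_kernel_deriv :: "real \<Rightarrow> real \<Rightarrow> real" where
  "abr_kernel_deriv \<alpha> s =
     deriv (mittag_leffler \<alpha>) (- \<alpha> / (1 - \<alpha>) * s powr \<alpha>) * (- \<alpha> / (1 - \<alpha>) * \<alpha>) * s powr (\<alpha> - 1)"

lemma abr_kernel_deriv_measurable [measurable]:
  assumes "0 < \<alpha>"
  shows "abr_kernel_deriv \<alpha> \<in> borel_measurable borel"
proof -
  have [measurable]: "(deriv (mittag_leffler \<alpha>) :: real \<Rightarrow> real) \<in> borel_measurable borel"
    by (intro borel_measurable_continuous_onI continuous_deriv_mittag_leffler assms)
  show ?thesis
    unfolding abr_kernel_deriv_def by measurable
qed

lemma continuous_on_powr_left:
  assumes "0 < (\<alpha>::real)"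
  shows "continuous_on {0..} (\<lambda>s. s powr \<alpha>)"
  using assms by (intro continuous_on_powr' continuous_intros) auto

text \<open>A continuous, hence bounded, factor multiplies \<open>s powr (\<alpha> - 1)\<close>,
  which is integrable at 0 because \<open>\<alpha> - 1 > -1\<close>.\<close>

lemma set_integrable_abr_kernel_deriv:
  assumes "0 < \<alpha>" "0 \<le> T"
  shows "set_integrable lborel {0..T} (abr_kernel_deriv \<alpha>)"
proof -
  define h where "h = (\<lambda>s. deriv (mittag_leffler \<alpha>) (- \<alpha> / (1 - \<alpha>) * s powr \<alpha>) * (- \<alpha> / (1 - \<alpha>) * \<alpha>))"
  have "continuous_on {0..T} h"
    unfolding h_def
    by (intro continuous_intros continuous_on_compose2[OF continuous_deriv_mittag_leffler[OF assms(1)]]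
          continuous_on_subset[OF continuous_on_powr_left]) (use assms in auto)
  then have "bounded (h ` {0..T})"
    by (intro compact_imp_bounded compact_continuous_image) auto
  then obtain C where C: "\<And>s. s \<in> {0..T} \<Longrightarrow> \<bar>h s\<bar> \<le> C"
    unfolding bounded_iff by (auto simp del: atLeastAtMost_iff)
  have "(\<lambda>s. C * s powr (\<alpha> - 1)) integrable_on {0..T}"
    using has_integral_powr_from_0[of "\<alpha> - 1" T] assms
    by (intro integrable_on_mult_right has_integral_integrable) auto
  moreover have "norm (abr_kernel_deriv \<alpha> s) \<le> C * s powr (\<alpha> - 1)" if "s \<in> {0..T}" for s
  proof -
    have "abr_kernel_deriv \<alpha> s = h s * s powr (\<alpha> - 1)"
      by (simp add: abr_kernel_deriv_def h_def)
    then show ?thesis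
      using C[OF that] by (auto simp: abs_mult intro!: mult_right_mono)
  qed
  moreover have "abr_kernel_deriv \<alpha> \<in> borel_measurable (lebesgue_on {0..T})"
    using abr_kernel_deriv_measurable[OF assms(1)]
    by (intro measurable_restrict_space1 measurable_completion) simp
  ultimately have "abr_kernel_deriv \<alpha> absolutely_integrable_on {0..T}"
    by (intro measurable_bounded_by_integrable_imp_absolutely_integrable) auto
  \<comment> \<open>The integrability obtained is over \<open>lebesgue\<close>; Borel measurability
    carries it to \<open>lborel\<close>.\<close>
  then show ?thesis
    using abr_kernel_deriv_measurable[OF assms(1)]
    unfolding set_integrable_def by (subst (asm) integrable_completion) auto
qed

lemma continuous_on_abr_kernel:
  assumes "0 < \<alpha>"
  shows "continuous_on {0..} (abr_kernel \<alpha>)"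
proof -
  have "continuous_on UNIV (mittag_leffler \<alpha> :: real \<Rightarrow> real)"
    using DERIV_mittag_leffler[OF assms]
    by (auto simp: continuous_on_eq_continuous_at intro: DERIV_isCont)
  note * = continuous_on_compose2[OF this
      continuous_on_mult[OF continuous_on_const continuous_on_powr_left[OF assms]]]
  show ?thesis
    unfolding abr_kernel_def by (rule *) simp
qed

lemma abr_kernel_eq_integral:
  assumes "0 < \<alpha>" "0 \<le> T"
  shows "abr_kernel \<alpha> T = 1 + (LINT s:{0..T}|lborel. abr_kernel_deriv \<alpha> s)"
proof -
  have "((\<lambda>s. abr_kernel_deriv \<alpha> s) has_integral (abr_kernel \<alpha> T - abr_kernel \<alpha> 0)) {0..T}"
  \<comment> \<open>Differentiability is required only in the open interval, which avoids the
    singularity at 0.\<close>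
  proof (rule fundamental_theorem_of_calculus_interior[OF assms(2)])
    show "continuous_on {0..T} (abr_kernel \<alpha>)"
      by (rule continuous_on_subset[OF continuous_on_abr_kernel[OF assms(1)]]) auto
    show "(abr_kernel \<alpha> has_vector_derivative abr_kernel_deriv \<alpha> s) (at s)" if "s \<in> {0<..<T}" for s
      unfolding abr_kernel_def abr_kernel_deriv_def has_real_derivative_iff_has_vector_derivative[symmetric]
      using that
      by (intro DERIV_cong[OF DERIV_chain2[OF DERIV_mittag_leffler[OF assms(1)]
              DERIV_cmult[OF has_real_derivative_powr]]]) simp_all
  qed
  \<comment> \<open>The series at 0 reduces to its zeroth term,
    \<open>1 / Gamma 1 = 1\<close>.\<close>
  moreover have "abr_kernel \<alpha> 0 = 1"
    unfolding abr_kernel_def mittag_leffler_powser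
    using powser_zero[of "\<lambda>k. inverse (Gamma (\<alpha> * real k + 1))"] by simp
  ultimately show ?thesis
    using set_borel_integral_eq_integral(2)[OF set_integrable_abr_kernel_deriv[OF assms]]
    by (simp add: integral_unique)
qed

subsection \<open>Convolution with an integrable kernel\<close>

text \<open>Supplies the hypothesis of Fubini's theorem: by translation invariance the
  \<open>s\<close>-integral of \<open>\<bar>j (s - x)\<bar>\<close> does not depend on
  \<open>x\<close>, so integrability of \<open>f\<close> settles the \<open>x\<close>-integral; the
  bounded factor \<open>g\<close> preserves this.\<close>

lemma integrable_mult_convolution_kernel:
  fixes f g :: "real \<Rightarrow> complex" and j :: "real \<Rightarrow> real"
  assumes f: "integrable lborel f" and j: "integrable lborel j"
    and [measurable]: "g \<in> borel_measurable borel" and M: "\<And>s. norm (g s) \<le> M"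
  shows "integrable (lborel \<Otimes>\<^sub>M lborel) (\<lambda>(x, s). g s * (f x * of_real (j (s - x))))"
proof -
  note [measurable] = borel_measurable_integrable[OF f] borel_measurable_integrable[OF j]
  have sh: "integrable lborel (\<lambda>s. j (s - x))" for x
    using lborel_integrable_real_affine[OF j, of 1 "- x"] by simp
  have "integrable (lborel \<Otimes>\<^sub>M lborel) (\<lambda>(x, s). f x * of_real (j (s - x)))"
  proof (rule lborel_pair.Fubini_integrable)
    show "(\<lambda>(x, s). f x * complex_of_real (j (s - x))) \<in> borel_measurable (lborel \<Otimes>\<^sub>M lborel)"
      by measurable
    have "(\<integral>s. \<bar>j (s - x)\<bar> \<partial>lborel) = (\<integral>s. \<bar>j s\<bar> \<partial>lborel)" for x
      using lborel_integral_real_affine[of 1 "\<lambda>s. \<bar>j s\<bar>" "- x"] by simp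
    then show "integrable lborel
      (\<lambda>x. \<integral>s. norm (case (x, s) of (x, s) \<Rightarrow> f x * complex_of_real (j (s - x))) \<partial>lborel)"
      using f by (simp add: norm_mult integrable_norm)
    show "AE x in lborel.
      integrable lborel (\<lambda>s. case (x, s) of (x, s) \<Rightarrow> f x * complex_of_real (j (s - x)))"
      using sh by (auto intro!: integrable_mult_right)
  qed
  then have "integrable (lborel \<Otimes>\<^sub>M lborel)
    (\<lambda>z. of_real M * (case z of (x, s) \<Rightarrow> f x * complex_of_real (j (s - x))))"
    by (rule integrable_mult_right)
  moreover have "M \<ge> 0"
    using M[of 0] norm_ge_zero order_trans by blast
  ultimately show ?thesis
    by (elim Bochner_Integration.integrable_bound)
       (auto simp: norm_mult intro!: AE_I2 mult_right_mono M)
qed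

text \<open>Both outer integrals are iterated integrals of one integrable function of two variables,
  taken in opposite orders.\<close>

lemma convolution_adjoint:
  fixes f g :: "real \<Rightarrow> complex" and j :: "real \<Rightarrow> real"
  assumes "integrable lborel f" "integrable lborel j"
    and "g \<in> borel_measurable borel" "\<And>s. norm (g s) \<le> M"
  shows "integrable lborel (\<lambda>s. g s * (\<integral>x. f x * of_real (j (s - x)) \<partial>lborel))"
    and "integrable lborel (\<lambda>x. f x * (\<integral>s. g s * of_real (j (s - x)) \<partial>lborel))"
    and "(\<integral>s. g s * (\<integral>x. f x * of_real (j (s - x)) \<partial>lborel) \<partial>lborel) =
         (\<integral>x. f x * (\<integral>s. g s * of_real (j (s - x)) \<partial>lborel) \<partial>lborel)"
proof -
  note int = integrable_mult_convolution_kernel[OF assms]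
  have *: "(\<integral>s. g s * (f x * of_real (j (s - x))) \<partial>lborel) =
    f x * (\<integral>s. g s * of_real (j (s - x)) \<partial>lborel)" for x
    by (simp add: mult.left_commute)
  show "integrable lborel (\<lambda>s. g s * (\<integral>x. f x * of_real (j (s - x)) \<partial>lborel))"
    using lborel_pair.integrable_snd[OF int] by simp
  show "integrable lborel (\<lambda>x. f x * (\<integral>s. g s * of_real (j (s - x)) \<partial>lborel))"
    using lborel_pair.integrable_fst[OF int] by (simp add: *)
  show "(\<integral>s. g s * (\<integral>x. f x * of_real (j (s - x)) \<partial>lborel) \<partial>lborel) =
        (\<integral>x. f x * (\<integral>s. g s * of_real (j (s - x)) \<partial>lborel) \<partial>lborel)"
    using lborel_pair.Fubini_integral[OF int] by (simp add: *)
qed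

text \<open>After a change of variable \<open>s\<close> sits in the argument of the bounded
  \<open>f\<close> instead of the merely integrable \<open>j\<close>; dominated convergence with
  majorant \<open>M * \<bar>j y\<bar>\<close> then applies.\<close>

lemma isCont_convolution:
  fixes f :: "real \<Rightarrow> complex" and j :: "real \<Rightarrow> real"
  assumes j: "integrable lborel j" and [measurable]: "f \<in> borel_measurable borel"
    and M: "\<And>s. norm (f s) \<le> M" and S: "finite S" "\<And>x. x \<notin> S \<Longrightarrow> isCont f x"
  shows "isCont (\<lambda>s. \<integral>x. f x * of_real (j (s - x)) \<partial>lborel) s"
proof -
  note [measurable] = borel_measurable_integrable[OF j]
  have "(\<integral>x. f x * of_real (j (s - x)) \<partial>lborel) = (\<integral>y. f (s - y) * of_real (j y) \<partial>lborel)" for s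
    by (subst lborel_integral_real_affine[where c = "-1" and t = s]) auto
  moreover have "isCont (\<lambda>s. \<integral>y. f (s - y) * of_real (j y) \<partial>lborel) s"
    unfolding continuous_at_sequentially comp_def
  proof (intro allI impI)
    fix X :: "nat \<Rightarrow> real" assume X: "X \<longlonglongrightarrow> s"
    show "(\<lambda>n. \<integral>y. f (X n - y) * of_real (j y) \<partial>lborel) \<longlonglongrightarrow>
      (\<integral>y. f (s - y) * of_real (j y) \<partial>lborel)"
    proof (rule integral_dominated_convergence)
      show "integrable lborel (\<lambda>y. M * \<bar>j y\<bar>)"
        using j by auto
      \<comment> \<open>Convergence of \<open>f (X n - y)\<close> can fail only if
        \<open>s - y\<close> lies in \<open>S\<close>, that is, for finitely many
        \<open>y\<close>.\<close>
      have "AE y in lborel. y \<notin> (\<lambda>x. s - x) ` S"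
        using S(1) by (intro AE_not_in finite_imp_null_set_lborel finite_imageI)
      then show "AE y in lborel. (\<lambda>n. f (X n - y) * of_real (j y)) \<longlonglongrightarrow> f (s - y) * of_real (j y)"
      proof eventually_elim
        case (elim y)
        then have "s - y \<notin> S"
          by (auto simp: image_iff)
        then have "isCont f (s - y)"
          by (rule S(2))
        then show ?case
          using X by (intro tendsto_intros isCont_tendsto_compose[of _ f])
      qed
    qed (auto simp: norm_mult intro!: AE_I2 mult_right_mono M)
  qed
  ultimately show ?thesis
    by simp
qed

subsection \<open>Integral operators of the second kind\<close>

text \<open>Identity plus convolution over \<open>[a,b]\<close>, as in Fredholm equations of the
  second kind. One form serves both derivatives: the support of \<open>j\<close> decides whether
  values to the left or to the right of \<open>s\<close> enter.\<close>

definition second_kind ::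
  "real \<Rightarrow> real \<Rightarrow> (real \<Rightarrow> real) \<Rightarrow> (real \<Rightarrow> complex) \<Rightarrow> real \<Rightarrow> complex" where
  "second_kind a b j f s = f s + (LINT x:{a..b}|lborel. f x * of_real (j (s - x)))"

lemma second_kind_eq_convolution:
  "second_kind a b j f s = f s + (\<integral>x. (indicator {a..b} x *\<^sub>R f x) * of_real (j (s - x)) \<partial>lborel)"
  by (simp add: second_kind_def set_lebesgue_integral_def)

lemma cnj_second_kind: "cnj (second_kind a b j f s) = second_kind a b j (\<lambda>x. cnj (f x)) s"
  by (simp add: second_kind_def set_lebesgue_integral_def flip: Bochner_Integration.integral_cnj)

text \<open>The convolution lemmas live on the whole line; extension by zero meets their
  assumptions, with jumps possible only at \<open>a\<close> and \<open>b\<close>.\<close>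

lemma continuous_on_Icc_extend_by_zero:
  fixes f :: "real \<Rightarrow> complex"
  assumes "continuous_on {a..b} f"
  shows "integrable lborel (\<lambda>x. indicator {a..b} x *\<^sub>R f x)"
    and "(\<lambda>x. indicator {a..b} x *\<^sub>R f x) \<in> borel_measurable borel"
    and "\<exists>M. \<forall>x. norm (indicator {a..b} x *\<^sub>R f x) \<le> M"
    and "x \<notin> {a, b} \<Longrightarrow> isCont (\<lambda>x. indicator {a..b} x *\<^sub>R f x) x"
proof -
  show "integrable lborel (\<lambda>x. indicator {a..b} x *\<^sub>R f x)"
    by (rule borel_integrable_compact[OF compact_Icc assms])
  show "(\<lambda>x. indicator {a..b} x *\<^sub>R f x) \<in> borel_measurable borel"
    by (rule borel_measurable_continuous_on_indicator[OF _ assms]) simp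
  have "bounded (f ` {a..b})"
    by (intro compact_imp_bounded compact_continuous_image assms compact_Icc)
  then obtain M where "\<And>x. x \<in> {a..b} \<Longrightarrow> norm (f x) \<le> M"
    unfolding bounded_iff by blast
  then have "norm (indicator {a..b} x *\<^sub>R f x) \<le> max M 0" for x
    by (auto simp: indicator_def max.coboundedI1)
  then show "\<exists>M. \<forall>x. norm (indicator {a..b} x *\<^sub>R f x) \<le> M"
    by blast
  assume x: "x \<notin> {a, b}"
  have "continuous_on ({a<..<b} \<union> - {a..b}) (\<lambda>x. indicator {a..b} x *\<^sub>R f x)"
  proof (rule continuous_on_open_Un)
    show "continuous_on {a<..<b} (\<lambda>x. indicator {a..b} x *\<^sub>R f x)"
      by (rule continuous_on_eq[OF continuous_on_subset[OF assms]]) auto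
    show "continuous_on (- {a..b}) (\<lambda>x. indicator {a..b} x *\<^sub>R f x)"
      by (rule continuous_on_eq[OF continuous_on_const[of _ 0]]) auto
  qed (auto intro: open_Compl)
  moreover have "open ({a<..<b} \<union> - {a..b})" "x \<in> {a<..<b} \<union> - {a..b}"
    using x by (auto intro!: open_Un open_Compl)
  ultimately show "isCont (\<lambda>x. indicator {a..b} x *\<^sub>R f x) x"
    using continuous_on_eq_continuous_at by blast
qed

lemma continuous_on_second_kind:
  assumes "continuous_on {a..b} f" "integrable lborel j"
  shows "continuous_on {a..b} (second_kind a b j f)"
proof -
  note f = continuous_on_Icc_extend_by_zero[OF assms(1)]
  obtain M where "\<And>x. norm (indicator {a..b} x *\<^sub>R f x) \<le> M"
    using f(3) by blast
  then have "isCont (\<lambda>s. \<integral>x. (indicator {a..b} x *\<^sub>R f x) * of_real (j (s - x)) \<partial>lborel) s" for s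
    by (rule isCont_convolution[OF assms(2) f(2), where S = "{a, b}"]) (use f(4) in auto)
  then show ?thesis
    unfolding second_kind_eq_convolution
    by (intro continuous_on_add assms(1) continuous_at_imp_continuous_on) auto
qed

text \<open>The identity parts agree, and Fubini's theorem transposes the convolution kernel
  \<open>j (s - x)\<close>, which amounts to reflecting \<open>j\<close>.\<close>

lemma second_kind_adjoint:
  assumes f: "continuous_on {a..b} f" and g: "continuous_on {a..b} g" and j: "integrable lborel j"
  shows "(LINT s:{a..b}|lborel. second_kind a b j f s * g s) =
         (LINT x:{a..b}|lborel. f x * second_kind a b (\<lambda>y. j (- y)) g x)"
proof -
  define f0 where "f0 = (\<lambda>x. indicator {a..b} x *\<^sub>R f x)"
  define g0 where "g0 = (\<lambda>x. indicator {a..b} x *\<^sub>R g x)"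
  note f0 = continuous_on_Icc_extend_by_zero[OF f, folded f0_def]
  note g0 = continuous_on_Icc_extend_by_zero[OF g, folded g0_def]
  obtain M where M: "\<And>s. norm (g0 s) \<le> M"
    using g0(3) unfolding g0_def by blast
  note adj = convolution_adjoint[OF f0(1) j g0(2) M]
  have fg: "integrable lborel (\<lambda>x. f0 x * g0 x)"
    using borel_integrable_compact[OF compact_Icc continuous_on_mult[OF f g]]
    by (rule Bochner_Integration.integrable_cong[THEN iffD1, rotated -1])
       (auto simp: f0_def g0_def indicator_def)
  have "(LINT s:{a..b}|lborel. second_kind a b j f s * g s) =
        (\<integral>s. f0 s * g0 s + g0 s * (\<integral>x. f0 x * of_real (j (s - x)) \<partial>lborel) \<partial>lborel)"
    unfolding set_lebesgue_integral_def second_kind_eq_convolution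
    by (intro Bochner_Integration.integral_cong)
       (auto simp: f0_def g0_def indicator_def algebra_simps)
  also have "\<dots> = (\<integral>x. f0 x * g0 x + f0 x * (\<integral>s. g0 s * of_real (j (s - x)) \<partial>lborel) \<partial>lborel)"
    by (simp add: Bochner_Integration.integral_add fg adj)
  also have "\<dots> = (LINT x:{a..b}|lborel. f x * second_kind a b (\<lambda>y. j (- y)) g x)"
    unfolding set_lebesgue_integral_def second_kind_eq_convolution
    by (intro Bochner_Integration.integral_cong)
       (auto simp: f0_def g0_def indicator_def algebra_simps)
  finally show ?thesis .
qed

text \<open>The integrand cut off to the interval is Borel, so completing the measure keeps its
  integral. This links the definitions over \<open>lebesgue\<close> to Fubini's theorem over
  \<open>lborel\<close>.\<close>

lemma set_lebesgue_integral_lborel: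
  fixes f :: "real \<Rightarrow> complex"
  assumes "continuous_on {c..d} f"
  shows "(LINT x:{c..d}|lebesgue. f x) = (LINT x:{c..d}|lborel. f x)"
  unfolding set_lebesgue_integral_def
  by (rule integral_completion) (simp add: continuous_on_Icc_extend_by_zero(2)[OF assms])

text \<open>Common core of both derivatives, with \<open>{c..d}\<close> being \<open>{a..s}\<close>
  or \<open>{s..b}\<close>: testing the convolution against the indicator of \<open>{c..d}\<close>
  and exchanging the integrals leaves the weight \<open>w x - 1\<close>, and the identity part
  supplies the missing 1.\<close>

lemma integral_memory_kernel:
  assumes f: "continuous_on {a..b} f" and j: "integrable lborel j"
    and cd: "{c..d} \<subseteq> {a..b}" and w: "continuous_on {c..d} w"
    and w_eq: "\<And>x. x \<in> {c..d} \<Longrightarrow> w x = 1 + (LINT s:{c..d}|lborel. j (s - x))"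
    and j0: "\<And>x s. x \<in> {a..b} - {c..d} \<Longrightarrow> s \<in> {c..d} \<Longrightarrow> j (s - x) = 0"
  shows "(LINT x:{c..d}|lebesgue. f x * of_real (w x)) = integral {c..d} (second_kind a b j f)"
proof -
  define f0 where "f0 = (\<lambda>x. indicator {a..b} x *\<^sub>R f x)"
  note f0 = continuous_on_Icc_extend_by_zero[OF f, folded f0_def]
  have fcd: "continuous_on {c..d} f"
    using f cd by (rule continuous_on_subset)
  have "(\<lambda>s. indicator {c..d} s :: complex) \<in> borel_measurable borel"
    "\<And>s. norm (indicator {c..d} s :: complex) \<le> 1"
    by (auto simp: indicator_def)
  note adj = convolution_adjoint[OF f0(1) j this]
  have inner: "f0 x * (\<integral>s. indicator {c..d} s * of_real (j (s - x)) \<partial>lborel) =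
    indicator {c..d} x *\<^sub>R (f x * (of_real (w x) - 1))" for x
  proof -
    \<comment> \<open>In the three cases \<open>w_eq\<close> evaluates the integral,
      \<open>j0\<close> makes it vanish, and \<open>f0 x\<close> is zero, respectively.\<close>
    consider "x \<in> {c..d}" | "x \<in> {a..b} - {c..d}" | "x \<notin> {a..b}"
      by blast
    then show ?thesis
    proof cases
      case 1
      have "(\<integral>s. indicator {c..d} s * complex_of_real (j (s - x)) \<partial>lborel) =
            (\<integral>s. complex_of_real (indicator {c..d} s *\<^sub>R j (s - x)) \<partial>lborel)"
        by (intro Bochner_Integration.integral_cong) (auto simp: indicator_def)
      also have "\<dots> = of_real (LINT s:{c..d}|lborel. j (s - x))"
        unfolding set_lebesgue_integral_def by (rule integral_complex_of_real)
      also have "\<dots> = of_real (w x) - 1"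
        using w_eq[OF 1] by simp
      finally show ?thesis
        using 1 cd by (auto simp: f0_def)
    next
      case 2
      have "(\<integral>s. indicator {c..d} s * complex_of_real (j (s - x)) \<partial>lborel) =
        (\<integral>s. 0 \<partial>(lborel :: real measure))"
        by (rule Bochner_Integration.integral_cong) (use j0[OF 2] in \<open>auto simp: indicator_def\<close>)
      then show ?thesis
        using 2 by simp
    next
      case 3
      then show ?thesis
        using cd by (auto simp: f0_def indicator_def)
    qed
  qed
  have fint: "integrable lborel (\<lambda>s. indicator {c..d} s *\<^sub>R f s)"
    by (rule continuous_on_Icc_extend_by_zero(1)[OF fcd])
  have "integral {c..d} (second_kind a b j f) = (LINT s:{c..d}|lborel. second_kind a b j f s)"
    using continuous_on_subset[OF continuous_on_second_kind[OF f j] cd]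
    by (intro set_borel_integral_eq_integral(2)[symmetric])
       (auto simp: set_integrable_def intro: borel_integrable_compact)
  also have "\<dots> = (\<integral>s. indicator {c..d} s *\<^sub>R f s +
      indicator {c..d} s * (\<integral>x. f0 x * of_real (j (s - x)) \<partial>lborel) \<partial>lborel)"
    unfolding set_lebesgue_integral_def second_kind_eq_convolution
    by (intro Bochner_Integration.integral_cong) (auto simp: f0_def indicator_def)
  also have "\<dots> = (\<integral>x. indicator {c..d} x *\<^sub>R f x +
      indicator {c..d} x *\<^sub>R (f x * (of_real (w x) - 1)) \<partial>lborel)"
    using adj(2) unfolding inner
    by (simp add: Bochner_Integration.integral_add fint adj(1) adj(3)[unfolded inner])
  also have "\<dots> = (LINT x:{c..d}|lborel. f x * of_real (w x))"
    unfolding set_lebesgue_integral_def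
    by (intro Bochner_Integration.integral_cong) (auto simp: indicator_def algebra_simps)
  also have "\<dots> = (LINT x:{c..d}|lebesgue. f x * of_real (w x))"
    by (intro set_lebesgue_integral_lborel[symmetric] continuous_intros fcd w)
  finally show ?thesis
    by simp
qed

subsection \<open>The ABR derivatives\<close>

text \<open>Cut off at \<open>b - a\<close>, the largest argument occurring on \<open>[a,b]\<close>, to be integrable on the whole
  line; vanishing at negative arguments encodes that only \<open>x \<le> t\<close> contributes on the left.\<close>

definition memory_kernel :: "real \<Rightarrow> real \<Rightarrow> real \<Rightarrow> real \<Rightarrow> real" where
  "memory_kernel \<alpha> a b y = indicator {0..b - a} y * abr_kernel_deriv \<alpha> y"

lemma integrable_memory_kernel:
  assumes "0 < \<alpha>" "a \<le> b"
  shows "integrable lborel (memory_kernel \<alpha> a b)"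
  using set_integrable_abr_kernel_deriv[of \<alpha> "b - a"] assms
  by (simp add: set_integrable_def memory_kernel_def[abs_def])

lemma integrable_memory_kernel_reflected:
  assumes "0 < \<alpha>" "a \<le> b"
  shows "integrable lborel (\<lambda>y. memory_kernel \<alpha> a b (- y))"
  using lborel_integrable_real_affine[OF integrable_memory_kernel[OF assms], of "-1" 0] by simp

text \<open>The substitution \<open>y = s - x\<close> leads to an integral over
  \<open>{0..t - x}\<close>: the kernel discards \<open>y < 0\<close>, and its support reaches far
  enough since \<open>t - x \<le> b - a\<close>.\<close>

lemma abr_kernel_eq_memory_left:
  assumes "0 < \<alpha>" "x \<in> {a..t}" "t \<le> b"
  shows "abr_kernel \<alpha> (t - x) = 1 + (LINT s:{a..t}|lborel. memory_kernel \<alpha> a b (s - x))"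
proof -
  have "(LINT s:{a..t}|lborel. memory_kernel \<alpha> a b (s - x)) =
        (\<integral>y. indicator {a..t} (x + 1 * y) *\<^sub>R memory_kernel \<alpha> a b (x + 1 * y - x) \<partial>lborel)"
    unfolding set_lebesgue_integral_def
    by (subst lborel_integral_real_affine[where c = 1 and t = x]) auto
  also have "\<dots> = (LINT y:{0..t - x}|lborel. abr_kernel_deriv \<alpha> y)"
    unfolding set_lebesgue_integral_def
    using assms by (intro Bochner_Integration.integral_cong) (auto simp: memory_kernel_def indicator_def)
  finally show ?thesis
    using abr_kernel_eq_integral[of \<alpha> "t - x"] assms by simp
qed

text \<open>Mirror image of the left case: the substitution is \<open>y = x - s\<close>, hence the
  factor \<open>- 1\<close>.\<close>

lemma abr_kernel_eq_memory_right:
  assumes "0 < \<alpha>" "x \<in> {t..b}" "a \<le> t"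
  shows "abr_kernel \<alpha> (x - t) = 1 + (LINT s:{t..b}|lborel. memory_kernel \<alpha> a b (- (s - x)))"
proof -
  have "(LINT s:{t..b}|lborel. memory_kernel \<alpha> a b (- (s - x))) =
        (\<integral>y. indicator {t..b} (x + - 1 * y) *\<^sub>R memory_kernel \<alpha> a b (- (x + - 1 * y - x)) \<partial>lborel)"
    unfolding set_lebesgue_integral_def
    by (subst lborel_integral_real_affine[where c = "- 1" and t = x]) auto
  also have "\<dots> = (LINT y:{0..x - t}|lborel. abr_kernel_deriv \<alpha> y)"
    unfolding set_lebesgue_integral_def
    using assms by (intro Bochner_Integration.integral_cong) (auto simp: memory_kernel_def indicator_def)
  finally show ?thesis
    using abr_kernel_eq_integral[of \<alpha> "x - t"] assms by simp
qed

lemma abr_left_eq: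
  assumes "0 < \<alpha>" "a < b" and f: "continuous_on {a..b} f" and t: "t \<in> {a..b}"
  shows "abr_left B \<alpha> a b f t = of_real (B \<alpha> / (1 - \<alpha>)) * second_kind a b (memory_kernel \<alpha> a b) f t"
proof -
  let ?F = "\<lambda>s. LINT x:{a..s}|lebesgue. f x * of_real (abr_kernel \<alpha> (s - x))"
  let ?h = "second_kind a b (memory_kernel \<alpha> a b) f"
  have int: "integrable lborel (memory_kernel \<alpha> a b)"
    using assms by (intro integrable_memory_kernel) auto
  have eq: "?F s = integral {a..s} ?h" if s: "s \<in> {a..b}" for s
  proof (rule integral_memory_kernel[OF f int])
    show "continuous_on {a..s} (\<lambda>x. abr_kernel \<alpha> (s - x))"
      by (intro continuous_on_compose2[OF continuous_on_abr_kernel[OF assms(1)]] continuous_intros) auto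
    show "abr_kernel \<alpha> (s - x) = 1 + (LINT s':{a..s}|lborel. memory_kernel \<alpha> a b (s' - x))" if "x \<in> {a..s}" for x
      using abr_kernel_eq_memory_left assms(1) s that by auto
  qed (use s in \<open>auto simp: memory_kernel_def indicator_def\<close>)
  have "((\<lambda>s. integral {a..s} ?h) has_vector_derivative ?h t) (at t within {a..b})"
    by (intro integral_has_vector_derivative continuous_on_second_kind f int t)
  then have "(?F has_vector_derivative ?h t) (at t within {a..b})"
    by (rule has_vector_derivative_transform[OF t, rotated]) (simp add: eq)
  \<comment> \<open>As \<open>a < b\<close>, the derivative within \<open>[a,b]\<close> is unique at
    the endpoints too.\<close>
  then have "vector_derivative ?F (at t within {a..b}) = ?h t"
    using vector_derivative_within_cbox[of a b t] assms by simp
  then show ?thesis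
    unfolding abr_left_def by simp
qed

lemma abr_right_eq:
  assumes "0 < \<alpha>" "a < b" and f: "continuous_on {a..b} f" and t: "t \<in> {a..b}"
  shows "abr_right B \<alpha> a b f t =
    of_real (B \<alpha> / (1 - \<alpha>)) * second_kind a b (\<lambda>y. memory_kernel \<alpha> a b (- y)) f t"
proof -
  let ?F = "\<lambda>s. LINT x:{s..b}|lebesgue. f x * of_real (abr_kernel \<alpha> (x - s))"
  let ?h = "second_kind a b (\<lambda>y. memory_kernel \<alpha> a b (- y)) f"
  have int: "integrable lborel (\<lambda>y. memory_kernel \<alpha> a b (- y))"
    using assms by (intro integrable_memory_kernel_reflected) auto
  note h = continuous_on_second_kind[OF f int]
  \<comment> \<open>Writing the integral over \<open>[s,b]\<close> as a difference produces a
    variable upper limit; the resulting minus sign cancels the one in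
    \<open>abr_right\<close>.\<close>
  have eq: "?F s = integral {a..b} ?h - integral {a..s} ?h" if s: "s \<in> {a..b}" for s
  proof -
    have "?F s = integral {s..b} ?h"
    proof (rule integral_memory_kernel[OF f int])
      show "continuous_on {s..b} (\<lambda>x. abr_kernel \<alpha> (x - s))"
        by (intro continuous_on_compose2[OF continuous_on_abr_kernel[OF assms(1)]] continuous_intros) auto
      show "abr_kernel \<alpha> (x - s) = 1 + (LINT s':{s..b}|lborel. memory_kernel \<alpha> a b (- (s' - x)))"
        if "x \<in> {s..b}" for x
        using abr_kernel_eq_memory_right assms(1) s that by auto
    qed (use s in \<open>auto simp: memory_kernel_def indicator_def\<close>)
    then show ?thesis
      using Henstock_Kurzweil_Integration.integral_combine[of a s b ?h] s
        integrable_continuous_real[OF h] by (simp add: algebra_simps)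
  qed
  have "((\<lambda>s. integral {a..b} ?h - integral {a..s} ?h) has_vector_derivative 0 - ?h t) (at t within {a..b})"
    by (intro has_vector_derivative_diff has_vector_derivative_const integral_has_vector_derivative h t)
  then have "(?F has_vector_derivative 0 - ?h t) (at t within {a..b})"
    by (rule has_vector_derivative_transform[OF t, rotated]) (simp add: eq)
  then have "vector_derivative ?F (at t within {a..b}) = 0 - ?h t"
    using vector_derivative_within_cbox[of a b t] assms by simp
  then show ?thesis
    unfolding abr_right_def by simp
qed

section \<open>The inner product and the symmetry of \<open>L1_op\<close>\<close>

lemma L2_inner_cong:
  assumes "\<And>t. t \<in> {a..b} \<Longrightarrow> cnj (u t) * v t = cnj (u' t) * v' t"
  shows "L2_inner a b u v = L2_inner a b u' v'"
  unfolding L2_inner_def by (rule set_lebesgue_integral_cong) (auto simp: assms)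

lemma cnj_L2_inner: "cnj (L2_inner a b u v) = L2_inner a b v u"
  unfolding L2_inner_def set_lebesgue_integral_def
  by (simp add: mult.commute flip: Bochner_Integration.integral_cnj)

lemma L2_inner_add_left:
  assumes "continuous_on {a..b} u" "continuous_on {a..b} u'" "continuous_on {a..b} v"
  shows "L2_inner a b (\<lambda>t. u t + u' t) v = L2_inner a b u v + L2_inner a b u' v"
proof -
  have "set_integrable lebesgue {a..b} (\<lambda>t. cnj (u t) * v t)"
       "set_integrable lebesgue {a..b} (\<lambda>t. cnj (u' t) * v t)"
    using assms by (auto intro!: absolutely_integrable_continuous_real continuous_intros)
  then show ?thesis
    unfolding L2_inner_def by (simp add: algebra_simps set_integral_add)
qed

text \<open>Constant and kernel are real, so conjugation reaches only \<open>f\<close>; the two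
  derivatives are then second-kind operators with mutually reflected kernels.\<close>

lemma L2_inner_abr_left:
  assumes "0 < \<alpha>" "a < b" and f: "continuous_on {a..b} f" and g: "continuous_on {a..b} g"
  shows "L2_inner a b (abr_left B \<alpha> a b f) g = L2_inner a b f (abr_right B \<alpha> a b g)"
proof -
  define c where "c = complex_of_real (B \<alpha> / (1 - \<alpha>))"
  let ?k = "memory_kernel \<alpha> a b"
  have int: "integrable lborel ?k" "integrable lborel (\<lambda>y. ?k (- y))"
    using assms by (auto intro: integrable_memory_kernel integrable_memory_kernel_reflected)
  have cf: "continuous_on {a..b} (\<lambda>x. cnj (f x))"
    by (intro continuous_intros f)
  have "L2_inner a b (abr_left B \<alpha> a b f) g =
        (LINT s:{a..b}|lebesgue. c * (second_kind a b ?k (\<lambda>x. cnj (f x)) s * g s))"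
    unfolding L2_inner_def
    by (rule set_lebesgue_integral_cong)
       (auto simp: abr_left_eq[OF assms(1,2) f] cnj_second_kind c_def simp del: of_real_divide)
  also have "\<dots> = c * (LINT s:{a..b}|lborel. second_kind a b ?k (\<lambda>x. cnj (f x)) s * g s)"
    by (subst set_lebesgue_integral_lborel) (auto intro!: continuous_intros continuous_on_second_kind cf g int)
  also have "\<dots> = c * (LINT x:{a..b}|lborel. cnj (f x) * second_kind a b (\<lambda>y. ?k (- y)) g x)"
    by (simp only: second_kind_adjoint[OF cf g int(1)])
  also have "\<dots> = (LINT x:{a..b}|lebesgue. c * (cnj (f x) * second_kind a b (\<lambda>y. ?k (- y)) g x))"
    by (subst set_lebesgue_integral_lborel) (auto intro!: continuous_intros continuous_on_second_kind f g int)
  also have "\<dots> = L2_inner a b f (abr_right B \<alpha> a b g)"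
    unfolding L2_inner_def
    by (rule set_lebesgue_integral_cong)
       (auto simp: abr_right_eq[OF assms(1,2) g] c_def simp del: of_real_divide)
  finally show ?thesis .
qed

theorem theorem5:
  fixes a b \<alpha> :: real and B p q r :: "real \<Rightarrow> real"
  assumes "a < b"
    and "0 < \<alpha>" and "\<alpha> < 1"
    and "B \<alpha> > 0"
    and "continuous_on {a..b} p" and "continuous_on {a..b} q" and "continuous_on {a..b} r"
    and "\<And>t. t \<in> {a..b} \<Longrightarrow> p t > 0" and "\<And>t. t \<in> {a..b} \<Longrightarrow> r t > 0"
  shows "\<forall>u \<in> L1_domain B \<alpha> a b p. \<forall>v \<in> L1_domain B \<alpha> a b p.
           L2_inner a b (L1_op B \<alpha> a b p q u) v = L2_inner a b u (L1_op B \<alpha> a b p q v)"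
proof (intro ballI)
  fix u v
  assume uv: "u \<in> L1_domain B \<alpha> a b p" "v \<in> L1_domain B \<alpha> a b p"
  let ?A = "abr_left B \<alpha> a b" and ?R = "abr_right B \<alpha> a b"
  let ?w = "\<lambda>x s. of_real (p s) * ?R x s"
  let ?q = "\<lambda>x t. of_real (q t) * x t"
  \<comment> \<open>Membership in \<open>H1\<close> supplies the first two continuity claims; the
    third follows from the second-kind form of the left derivative.\<close>
  have cont: "continuous_on {a..b} x" "continuous_on {a..b} (?w x)" "continuous_on {a..b} (?A (?w x))"
    if "x \<in> L1_domain B \<alpha> a b p" for x
  proof -
    show x: "continuous_on {a..b} x" and w: "continuous_on {a..b} (?w x)"
      using that by (auto simp: L1_domain_def H1_def)
    have "continuous_on {a..b} (\<lambda>t. of_real (B \<alpha> / (1 - \<alpha>)) * second_kind a b (memory_kernel \<alpha> a b) (?w x) t)"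
      using assms by (intro continuous_intros continuous_on_second_kind w integrable_memory_kernel) auto
    then show "continuous_on {a..b} (?A (?w x))"
      by (rule continuous_on_eq) (simp add: abr_left_eq[OF assms(2,1) w])
  qed
  \<comment> \<open>The outer left derivative moves to \<open>y\<close> as a right derivative,
    leaving right derivatives of both arguments with weight \<open>p\<close>.\<close>
  have split: "L2_inner a b (L1_op B \<alpha> a b p q x) y = L2_inner a b (?w x) (?R y) + L2_inner a b (?q x) y"
    if "x \<in> L1_domain B \<alpha> a b p" "y \<in> L1_domain B \<alpha> a b p" for x y
  proof -
    have "L2_inner a b (\<lambda>t. ?A (?w x) t + ?q x t) y = L2_inner a b (?A (?w x)) y + L2_inner a b (?q x) y"
      using cont[OF that(1)] cont[OF that(2)] assms(6)
      by (intro L2_inner_add_left continuous_on_mult continuous_on_of_real) auto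
    then show ?thesis
      using L2_inner_abr_left[OF assms(2,1) cont(2)[OF that(1)] cont(1)[OF that(2)]]
      by (simp add: L1_op_def[abs_def])
  qed
  have "L2_inner a b (L1_op B \<alpha> a b p q u) v = L2_inner a b (?w u) (?R v) + L2_inner a b (?q u) v"
    by (rule split[OF uv])
  \<comment> \<open>The real factors \<open>p\<close> and \<open>q\<close> pass to the other side of
    the inner product.\<close>
  also have "\<dots> = L2_inner a b (?R u) (?w v) + L2_inner a b u (?q v)"
    by (intro arg_cong2[where f = "(+)"] L2_inner_cong) auto
  \<comment> \<open>Here \<open>split\<close> is used with \<open>u\<close> and \<open>v\<close>
    exchanged; conjugate symmetry restores the order.\<close>
  also have "\<dots> = cnj (L2_inner a b (L1_op B \<alpha> a b p q v) u)"
    by (simp add: split[OF uv(2,1)] cnj_L2_inner)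
  also have "\<dots> = L2_inner a b u (L1_op B \<alpha> a b p q v)"
    by (rule cnj_L2_inner)
  finally show "L2_inner a b (L1_op B \<alpha> a b p q u) v = L2_inner a b u (L1_op B \<alpha> a b p q v)" .
qed

end
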